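(* Assume (A). Let $\bar v$ be a viscosity supersolution and $\underline v$ a viscosity subsolution of (E), both of class (L). Then $\underline v\le\bar v$ on $[0,\infty)$. Consequently, with $\hat v,v^*,v_*$ as in the context, $v^*=v_*=\hat v$, and this is the unique viscosity solution of class (L) of (E) on $[0,\infty)$.
   Context: Constants $\mu\in\mathbb R$, $\sigma>0$, $c>0$, $a>0$, $\lambda>0$; standing assumption (A): $a>\max\{1,2\mu\}$ and $\mu>\max\{c,\sigma^2/2\}$. $f(z)=\mu z+\lambda\ln\big[\lambda(e^{\frac{a}{\lambda}(1-z)}-1)/(1-z)\big]$ for $z\ne1$, $f(1)=\mu+\lambda\ln a$. (E) is $\frac12\sigma^2v''+f(v')-cv=0$ on $[0,\infty)$, $v(0)=0$. Viscosity sub/supersolution: upper (resp. lower) semicontinuous $u$ with $u(0)=0$ such that for all $x\in(0,\infty)$, $\varphi\in C^2(\mathbb R)$ with $0=(u-\varphi)(x)=\max_{(0,\infty)}(u-\varphi)$ (resp. $\min$): $\frac12\sigma^2\varphi''(x)+f(\varphi'(x))-cu(x)\ge0$ (resp. $\le0$); viscosity solution = continuous and both. Class (L): increasing and bounded on $[0,\infty)$. $\underline\psi(x)=1-e^{-x}$, $\overline\psi(x)=\frac AM(1-e^{-M(x\wedge b)})$ with $M,A,b$ chosen so that $\underline\psi$ is a viscosity subsolution, $\overline\psi$ a viscosity supersolution and $\underline\psi\le\overline\psi$. $\mathfrak F$ = continuous class (L) viscosity subsolutions $u$ with $\underline\psi\le u\le\overline\psi$; $\hat v=\sup_{u\in\mathfrak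 F}u$; $v^*,v_*$ are the upper and lower semicontinuous envelopes of $\hat v$. *)

theory Defs
  imports "HOL-Analysis.Analysis"
begin

definition fH :: "real \<Rightarrow> real \<Rightarrow> real \<Rightarrow> real \<Rightarrow> real" where
  "fH mu lam a z =
     (if z \<noteq> 1 then mu * z + lam * ln (lam * (exp (a / lam * (1 - z)) - 1) / (1 - z))
      else mu + lam * ln a)"

definition C2 :: "(real \<Rightarrow> real) \<Rightarrow> bool" where
  "C2 phi \<longleftrightarrow> (\<forall>y. phi differentiable (at y)) \<and> (\<forall>y. deriv phi differentiable (at y))
             \<and> continuous_on UNIV (deriv (deriv phi))"

definition usc_on :: "real set \<Rightarrow> (real \<Rightarrow> real) \<Rightarrow> bool" where
  "usc_on S u \<longleftrightarrow> (\<forall>x\<in>S. \<forall>e>0. \<exists>d>0. \<forall>y\<in>S. \<bar>y - x\<bar> < d \<longrightarrow> u y < u x + e)"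

definition lsc_on :: "real set \<Rightarrow> (real \<Rightarrow> real) \<Rightarrow> bool" where
  "lsc_on S u \<longleftrightarrow> (\<forall>x\<in>S. \<forall>e>0. \<exists>d>0. \<forall>y\<in>S. \<bar>y - x\<bar> < d \<longrightarrow> u x - e < u y)"

definition visc_sub :: "real \<Rightarrow> real \<Rightarrow> real \<Rightarrow> real \<Rightarrow> real \<Rightarrow> (real \<Rightarrow> real) \<Rightarrow> bool" where
  "visc_sub mu sig c a lam u \<longleftrightarrow>
     usc_on {0..} u \<and> u 0 = 0 \<and>
     (\<forall>x>0. \<forall>phi. C2 phi \<longrightarrow> u x - phi x = 0 \<longrightarrow> (\<forall>y>0. u y - phi y \<le> u x - phi x) \<longrightarrow>
        1/2 * sig\<^sup>2 * deriv (deriv phi) x + fH mu lam a (deriv phi x) - c * u x \<ge> 0)"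

definition visc_super :: "real \<Rightarrow> real \<Rightarrow> real \<Rightarrow> real \<Rightarrow> real \<Rightarrow> (real \<Rightarrow> real) \<Rightarrow> bool" where
  "visc_super mu sig c a lam u \<longleftrightarrow>
     lsc_on {0..} u \<and> u 0 = 0 \<and>
     (\<forall>x>0. \<forall>phi. C2 phi \<longrightarrow> u x - phi x = 0 \<longrightarrow> (\<forall>y>0. u y - phi y \<ge> u x - phi x) \<longrightarrow>
        1/2 * sig\<^sup>2 * deriv (deriv phi) x + fH mu lam a (deriv phi x) - c * u x \<le> 0)"

definition visc_sol :: "real \<Rightarrow> real \<Rightarrow> real \<Rightarrow> real \<Rightarrow> real \<Rightarrow> (real \<Rightarrow> real) \<Rightarrow> bool" where
  "visc_sol mu sig c a lam u \<longleftrightarrow>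
     continuous_on {0..} u \<and> visc_sub mu sig c a lam u \<and> visc_super mu sig c a lam u"

definition classL :: "(real \<Rightarrow> real) \<Rightarrow> bool" where
  "classL u \<longleftrightarrow> mono_on {0..} u \<and> bounded (u ` {0..})"

definition psi_low :: "real \<Rightarrow> real" where
  "psi_low x = 1 - exp (- x)"

definition psi_up :: "real \<Rightarrow> real \<Rightarrow> real \<Rightarrow> real \<Rightarrow> real" where
  "psi_up A M b x = A / M * (1 - exp (- M * min x b))"

definition famF :: "real \<Rightarrow> real \<Rightarrow> real \<Rightarrow> real \<Rightarrow> real \<Rightarrow> real \<Rightarrow> real \<Rightarrow> real \<Rightarrow>
                    (real \<Rightarrow> real) set" where
  "famF mu sig c a lam A M b =
     {u. continuous_on {0..} u \<and> classL u \<and> visc_sub mu sig c a lam u \<and>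
         (\<forall>x\<ge>0. psi_low x \<le> u x \<and> u x \<le> psi_up A M b x)}"

definition vhat :: "real \<Rightarrow> real \<Rightarrow> real \<Rightarrow> real \<Rightarrow> real \<Rightarrow> real \<Rightarrow> real \<Rightarrow> real \<Rightarrow> real \<Rightarrow> real" where
  "vhat mu sig c a lam A M b x = Sup ((\<lambda>u. u x) ` famF mu sig c a lam A M b)"

definition usc_env :: "(real \<Rightarrow> real) \<Rightarrow> real \<Rightarrow> real" where
  "usc_env v x = Inf ((\<lambda>d. Sup (v ` {y. 0 \<le> y \<and> \<bar>y - x\<bar> < d})) ` {0<..})"

definition lsc_env :: "(real \<Rightarrow> real) \<Rightarrow> real \<Rightarrow> real" where
  "lsc_env v x = Sup ((\<lambda>d. Inf (v ` {y. 0 \<le> y \<and> \<bar>y - x\<bar> < d})) ` {0<..})"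

end

theory Submission
  imports Defs
begin

text \<open>The Hamiltonian is a log-partition function, namely
  \<open>mu * z + lam * ln (integral over u in [0, a] of exp (u * (1 - z) / lam))\<close>, hence globally Lipschitz.
  So (E) is a second-order ODE with Lipschitz right-hand side, and shooting in the initial slope produces a
  bounded classical solution \<open>v\<close> with \<open>v 0 = 0\<close>. Every bounded viscosity subsolution lies below \<open>v\<close> and every
  bounded viscosity supersolution above it: \<open>v x + e * x\<close> is itself an admissible test function, so no
  doubling of variables is needed. Comparison follows, and \<open>v\<close> belongs to the Perron family, of which it is
  therefore the maximum.\<close>

text \<open>Comparing two merely semicontinuous functions normally forces doubling, because neither
  can be a test function for the other. Interposing one smooth solution splits the problem into two
  halves, each with a test function at hand. The price is that the smooth solution must be
  constructed beforehand and must be bounded: the tilt \<open>e * x\<close> confines the maximum to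
  a compact interval only for bounded functions. A prescribed initial slope gives no control at
  infinity, so the slope is selected by shooting. The term \<open>- c * v\<close> with
  \<open>c > 0\<close> acts twice. It absorbs the error \<open>L * e\<close> caused by the tilt, and
  it prevents a solution that has risen above \<open>|F 0| / c\<close> from coming back to zero,
  which is what separates the two sets of slopes. Monotonicity is not built into the shooting. It
  comes from comparing the selected solution with its translates, whose starting values are
  nonnegative thanks to \<open>psi_low\<close>.\<close>

section \<open>The Hamiltonian as a log-partition function\<close>

lemma exp_kernel_has_integral:
  fixes a lam y :: real
  assumes "a > 0" "lam > 0"
  shows "((\<lambda>u. exp (u * y / lam)) has_integral
           (if y \<noteq> 0 then lam * (exp (a / lam * y) - 1) / y else a)) {0..a}"
proof (cases "y = 0")
  \<comment> \<open>The value \<open>a\<close> fills the removable singularity; with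
    \<open>y = 1 - z\<close> it is the separate branch of \<open>fH\<close> at
    \<open>z = 1\<close>.\<close>
  case True
  then show ?thesis using assms has_integral_const_real[of "1::real" 0 a] by simp
next
  case False
  have "((\<lambda>u. exp (u * y / lam)) has_integral
          lam / y * exp (a * y / lam) - lam / y * exp (0 * y / lam)) {0..a}"
    using assms False
    by (intro fundamental_theorem_of_calculus)
      (auto intro!: derivative_eq_intros simp: has_real_derivative_iff_has_vector_derivative[symmetric])
  then show ?thesis using False by (simp add: field_simps)
qed

text \<open>Raising the parameter from \<open>t\<close> to \<open>r\<close> multiplies each kernel
  value by a factor between 1 and \<open>exp (a * (r - t) / lam)\<close>, uniformly for
  \<open>u\<close> in \<open>{0..a}\<close>. The integral inherits this factor, and
  \<open>lam * ln\<close> turns it into an increment between 0 and \<open>a * (r - t)\<close>; the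
  linear term contributes the summand with \<open>mu\<close>.\<close>

lemma fH_lipschitz:
  assumes "a > 0" "lam > 0"
  shows "\<bar>fH mu lam a y - fH mu lam a z\<bar> \<le> (\<bar>mu\<bar> + a) * \<bar>y - z\<bar>"
proof -
  define I where "I t = integral {0..a} (\<lambda>u. exp (u * t / lam))" for t
  have hasI: "((\<lambda>u. exp (u * t / lam)) has_integral I t) {0..a}" for t
    unfolding I_def using exp_kernel_has_integral[OF assms, of t] by (metis has_integral_integral has_integral_integrable)
  have I_eq: "I t = (if t \<noteq> 0 then lam * (exp (a / lam * t) - 1) / t else a)" for t
    using exp_kernel_has_integral[OF assms, of t] hasI[of t] has_integral_unique by blast
  have fH_eq: "fH mu lam a t = mu * t + lam * ln (I (1 - t))" for t
    by (simp add: fH_def I_eq)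
  have I_pos: "I t > 0" for t
  proof (cases "t > 0")
    case True
    then show ?thesis using assms by (simp add: I_eq)
  next
    case False
    show ?thesis
    proof (cases "t = 0")
      case True
      then show ?thesis using assms by (simp add: I_eq)
    next
      case ne: False
      with False have "t < 0" by simp
      then have "a / lam * t < 0" using assms by (intro mult_pos_neg) auto
      then have "exp (a / lam * t) - 1 < 0" by simp
      then show ?thesis using \<open>t < 0\<close> assms ne
        by (simp add: I_eq divide_neg_neg mult_pos_neg)
    qed
  qed
  have incr: "0 \<le> lam * ln (I r) - lam * ln (I t) \<and> lam * ln (I r) - lam * ln (I t) \<le> a * (r - t)"
    if "t \<le> r" for t r
  proof -
    have le: "I t \<le> I r"
      by (rule has_integral_le[OF hasI hasI]) (use that assms in \<open>auto intro!: divide_right_mono mult_left_mono\<close>)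
    have "((\<lambda>u. exp (a * (r - t) / lam) * exp (u * t / lam)) has_integral exp (a * (r - t) / lam) * I t) {0..a}"
      using hasI by (rule has_integral_mult_right)
    then have ge: "I r \<le> exp (a * (r - t) / lam) * I t"
    proof (rule has_integral_le[OF hasI])
      fix u assume u: "u \<in> {0..a}"
      have "u * (r - t) \<le> a * (r - t)" using u that by (intro mult_right_mono) auto
      then have "u * r \<le> a * (r - t) + u * t" by (simp add: algebra_simps)
      then have "u * r / lam \<le> a * (r - t) / lam + u * t / lam"
        using assms by (simp add: divide_right_mono flip: add_divide_distrib)
      then show "exp (u * r / lam) \<le> exp (a * (r - t) / lam) * exp (u * t / lam)"
        by (simp flip: exp_add)
    qed
    have "ln (I t) \<le> ln (I r)" using le I_pos by simp
    moreover have "ln (I r) \<le> a * (r - t) / lam + ln (I t)"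
    proof -
      have "ln (I r) \<le> ln (exp (a * (r - t) / lam) * I t)"
        using ge I_pos by (subst ln_le_cancel_iff) auto
      also have "\<dots> = a * (r - t) / lam + ln (I t)"
        using I_pos[of t] by (subst ln_mult) auto
      finally show ?thesis .
    qed
    ultimately show ?thesis using assms by (simp add: field_simps)
  qed
  have "\<bar>lam * ln (I (1 - y)) - lam * ln (I (1 - z))\<bar> \<le> a * \<bar>y - z\<bar>"
    using incr[of "1 - y" "1 - z"] incr[of "1 - z" "1 - y"] by (cases "y \<le> z") auto
  moreover have "\<bar>mu * y - mu * z\<bar> = \<bar>mu\<bar> * \<bar>y - z\<bar>"
    by (simp add: abs_mult flip: right_diff_distrib)
  ultimately show ?thesis unfolding fH_eq distrib_right by linarith
qed

section \<open>Calculus of test functions, and maxima\<close>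

lemma C2I:
  assumes "\<And>x. (v has_real_derivative v1 x) (at x)" "\<And>x. (v1 has_real_derivative v2 x) (at x)"
    "continuous_on UNIV v2"
  shows "C2 v" and "deriv v = v1" and "deriv (deriv v) = v2"
proof -
  show d1: "deriv v = v1" using assms(1) by (blast intro: DERIV_imp_deriv)
  show d2: "deriv (deriv v) = v2" unfolding d1 using assms(2) by (blast intro: DERIV_imp_deriv)
  from d1 d2 show "C2 v" unfolding C2_def d1 d2[unfolded d1]
    using assms real_differentiable_def by metis
qed

lemma C2D:
  assumes "C2 v"
  shows "(v has_real_derivative deriv v x) (at x)"
    and "(deriv v has_real_derivative deriv (deriv v) x) (at x)"
    and "continuous_on UNIV (deriv (deriv v))"
  using assms by (auto simp: C2_def DERIV_deriv_iff_real_differentiable)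

lemma C2_continuous_on: "C2 v \<Longrightarrow> continuous_on S v"
  using C2D(1) by (meson DERIV_isCont continuous_at_imp_continuous_on)

text \<open>The last equation has the form that remains after rewriting with the one before it, so
  second derivatives are computed by two successive rewrites.\<close>

lemma C2_uminus:
  assumes "C2 v"
  shows "C2 (\<lambda>x. - v x)" "deriv (\<lambda>x. - v x) = (\<lambda>x. - deriv v x)"
    "deriv (\<lambda>x. - deriv v x) = (\<lambda>x. - deriv (deriv v) x)"
proof -
  have *: "((\<lambda>x. - v x) has_real_derivative - deriv v x) (at x)"
    "((\<lambda>x. - deriv v x) has_real_derivative - deriv (deriv v) x) (at x)" for x
    by (intro derivative_intros C2D[OF assms])+
  have "continuous_on UNIV (\<lambda>x. - deriv (deriv v) x)"
    using C2D(3)[OF assms] by (intro continuous_intros)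
  note C = C2I[OF * this]
  then show "C2 (\<lambda>x. - v x)" "deriv (\<lambda>x. - v x) = (\<lambda>x. - deriv v x)"
    "deriv (\<lambda>x. - deriv v x) = (\<lambda>x. - deriv (deriv v) x)" using C(3)[unfolded C(2)] C by auto
qed

text \<open>Tilting leaves the second derivative alone, so in the equation it is felt only through
  the argument of the Hamiltonian.\<close>

lemma C2_add_affine:
  assumes "C2 v"
  shows "C2 (\<lambda>x. v x + (r * x + q))" "deriv (\<lambda>x. v x + (r * x + q)) = (\<lambda>x. deriv v x + r)"
    "deriv (deriv (\<lambda>x. v x + (r * x + q))) = deriv (deriv v)"
proof -
  have *: "((\<lambda>x. v x + (r * x + q)) has_real_derivative deriv v x + r) (at x)"
    "((\<lambda>x. deriv v x + r) has_real_derivative deriv (deriv v) x) (at x)" for x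
    by (auto intro!: derivative_eq_intros C2D[OF assms])
  note C2I[OF * C2D(3)[OF assms]]
  then show "C2 (\<lambda>x. v x + (r * x + q))" "deriv (\<lambda>x. v x + (r * x + q)) = (\<lambda>x. deriv v x + r)"
    "deriv (deriv (\<lambda>x. v x + (r * x + q))) = deriv (deriv v)" by auto
qed

lemma C2_translate:
  assumes "C2 v"
  shows "C2 (\<lambda>x. v (x + h))" "deriv (\<lambda>x. v (x + h)) = (\<lambda>x. deriv v (x + h))"
    "deriv (deriv (\<lambda>x. v (x + h))) = (\<lambda>x. deriv (deriv v) (x + h))"
proof -
  have *: "((\<lambda>x. v (x + h)) has_real_derivative deriv v (x + h)) (at x)"
    "((\<lambda>x. deriv v (x + h)) has_real_derivative deriv (deriv v) (x + h)) (at x)" for x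
    using C2D(1,2)[OF assms, of "x + h"] by (simp_all only: DERIV_shift)
  have "continuous_on UNIV (\<lambda>x. deriv (deriv v) (x + h))"
    by (rule continuous_on_compose2[OF C2D(3)[OF assms]]) (auto intro!: continuous_intros)
  note C2I[OF * this]
  then show "C2 (\<lambda>x. v (x + h))" "deriv (\<lambda>x. v (x + h)) = (\<lambda>x. deriv v (x + h))"
    "deriv (deriv (\<lambda>x. v (x + h))) = (\<lambda>x. deriv (deriv v) (x + h))" by auto
qed

text \<open>If \<open>D2\<close> were positive, \<open>d1\<close>, which vanishes at
  \<open>x\<close>, would be positive just to the right of \<open>x\<close>, and \<open>d\<close>
  would climb above its maximum.\<close>

lemma local_max_second_derivative:
  fixes d :: "real \<Rightarrow> real"
  assumes d1: "\<And>x. (d has_real_derivative d1 x) (at x)"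
    and d2: "(d1 has_real_derivative D2) (at x)"
    and "r > 0" and max: "\<And>y. \<bar>y - x\<bar> < r \<Longrightarrow> d y \<le> d x"
  shows "d1 x = 0" and "D2 \<le> 0"
proof -
  show z: "d1 x = 0"
    using DERIV_local_max[OF d1 \<open>r > 0\<close>] max by (simp add: abs_minus_commute)
  show "D2 \<le> 0"
  proof (rule ccontr)
    assume "\<not> D2 \<le> 0"
    then obtain e where e: "e > 0" "\<And>h. 0 < h \<Longrightarrow> h < e \<Longrightarrow> d1 x < d1 (x + h)"
      using DERIV_pos_inc_right[OF d2] by auto
    define h where "h = min e r / 2"
    have h: "0 < h" "h < e" "h < r" using e \<open>r > 0\<close> by (auto simp: h_def min_def)
    have "d x < d (x + h)"
    proof (rule DERIV_pos_imp_increasing_open[of x "x + h"])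
      show "\<exists>y. (d has_real_derivative y) (at t) \<and> 0 < y" if "x < t" "t < x + h" for t
        using e(2)[of "t - x"] that h z d1[of t] by auto
      show "continuous_on {x..x + h} d" using d1 DERIV_isCont by (blast intro: continuous_at_imp_continuous_on)
    qed (use h in auto)
    moreover have "d (x + h) \<le> d x" using max[of "x + h"] h by auto
    ultimately show False by simp
  qed
qed

lemma usc_attains_sup:
  fixes u :: "real \<Rightarrow> real"
  assumes "usc_on {a..b} u" "a \<le> b"
  shows "\<exists>x\<in>{a..b}. \<forall>y\<in>{a..b}. u y \<le> u x"
proof (rule ccontr)
  assume "\<not> ?thesis"
  then have "\<forall>x\<in>{a..b}. \<exists>y\<in>{a..b}. u x < u y" by (meson not_le)
  then obtain g where g: "\<And>x. x \<in> {a..b} \<Longrightarrow> g x \<in> {a..b} \<and> u x < u (g x)" by metis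
  \<comment> \<open>Semicontinuity is applied with the gap \<open>u (g x) - u x\<close>, so near
    \<open>x\<close> the function stays below the value at the better point
    \<open>g x\<close>.\<close>
  have "\<forall>x\<in>{a..b}. \<exists>d>0. \<forall>y\<in>{a..b}. \<bar>y - x\<bar> < d \<longrightarrow> u y < u x + (u (g x) - u x)"
    using assms g unfolding usc_on_def by (metis diff_gt_0_iff_gt)
  then obtain d where d: "\<And>x. x \<in> {a..b} \<Longrightarrow> d x > 0"
    "\<And>x y. x \<in> {a..b} \<Longrightarrow> y \<in> {a..b} \<Longrightarrow> \<bar>y - x\<bar> < d x \<Longrightarrow> u y < u (g x)"
    by (metis add.commute diff_add_cancel)
  have "compact {a..b}" by simp
  moreover have "{a..b} \<subseteq> (\<Union>x\<in>{a..b}. ball x (d x))" using d(1) by fastforce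
  ultimately obtain T where T: "T \<subseteq> {a..b}" "finite T" "{a..b} \<subseteq> (\<Union>x\<in>T. ball x (d x))"
    by (metis (no_types, lifting) compactE_image open_ball)
  have "T \<noteq> {}" using T assms by auto
  \<comment> \<open>The best of the finitely many points \<open>g x\<close> lies itself in one of
    the covering balls, and is thus beaten by another of them.\<close>
  define m where "m = Max ((\<lambda>x. u (g x)) ` T)"
  have "m \<in> (\<lambda>x. u (g x)) ` T" unfolding m_def using T \<open>T \<noteq> {}\<close> by (intro Max_in) auto
  then obtain z where z: "z \<in> T" "m = u (g z)" by auto
  have "g z \<in> {a..b}" using z T g by auto
  then obtain x where x: "x \<in> T" "g z \<in> ball x (d x)" using T by auto
  then have "u (g z) < u (g x)"
    using d(2)[of x "g z"] T \<open>g z \<in> {a..b}\<close> by (auto simp: dist_real_def abs_minus_commute)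
  moreover have "u (g x) \<le> m" unfolding m_def using T x by auto
  ultimately show False using z by simp
qed

section \<open>Comparison with a classical solution\<close>

text \<open>At a maximum of \<open>u - w - e * y\<close> the function \<open>w\<close> plus an
  affine term touches \<open>u\<close> from above. Subtracting the inequality for \<open>w\<close>
  cancels the second-order terms exactly and leaves \<open>c * (u - w) \<le> L * e\<close> there;
  then \<open>e\<close> tends to 0. \<open>F\<close> is kept abstract so that the reflected
  Hamiltonian can be inserted too.\<close>

lemma comparison_below_classical:
  fixes F u w :: "real \<Rightarrow> real"
  assumes "c > 0" and lip: "\<And>y z. \<bar>F y - F z\<bar> \<le> L * \<bar>y - z\<bar>"
    and usc: "usc_on {0..} u" and init: "u 0 \<le> w 0"
    and bu: "bounded (u ` {0..})" and bw: "bounded (w ` {0..})" and C2w: "C2 w"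
    and w: "\<And>x. x > 0 \<Longrightarrow> s * deriv (deriv w) x + F (deriv w x) - c * w x \<le> 0"
    and visc: "\<And>x phi. x > 0 \<Longrightarrow> C2 phi \<Longrightarrow> u x - phi x = 0 \<Longrightarrow>
       (\<forall>y>0. u y - phi y \<le> u x - phi x) \<Longrightarrow>
       s * deriv (deriv phi) x + F (deriv phi x) - c * u x \<ge> 0"
    and "x0 \<ge> 0"
  shows "u x0 \<le> w x0"
proof -
  have "L \<ge> 0" using lip[of 1 0] by simp
  obtain B1 B2 where B: "\<And>y. y \<ge> 0 \<Longrightarrow> \<bar>u y\<bar> \<le> B1" "\<And>y. y \<ge> 0 \<Longrightarrow> \<bar>w y\<bar> \<le> B2"
    using bu bw unfolding bounded_iff by fastforce
  have key: "u x0 - w x0 - e * x0 \<le> L * e / c" if e: "e > 0" for e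
  proof (rule ccontr)
    define g where "g y = u y - w y - e * y" for y
    assume "\<not> ?thesis"
    then have g0: "g x0 > L * e / c" by (simp add: g_def)
    then have gpos: "g x0 > 0" using \<open>L \<ge> 0\<close> \<open>c > 0\<close> e by (smt (verit) divide_nonneg_pos mult_nonneg_nonneg)
    \<comment> \<open>Beyond \<open>(B1 + B2) / e\<close> the penalty outweighs
      \<open>u - w\<close>, so \<open>g\<close> is negative there; the maximum with
      \<open>x0\<close> keeps \<open>x0\<close> in the interval.\<close>
    define R where "R = max x0 ((B1 + B2) / e)"
    have contw: "continuous_on {0..R} (\<lambda>y. w y + e * y)"
      by (intro continuous_intros C2_continuous_on C2w)
    have "usc_on {0..R} g"
      unfolding usc_on_def
    proof (intro ballI allI impI)
      fix x r :: real assume x: "x \<in> {0..R}" and "r > 0"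
      then obtain d1 where d1: "d1 > 0" "\<And>y. y \<ge> 0 \<Longrightarrow> \<bar>y - x\<bar> < d1 \<Longrightarrow> u y < u x + r/2"
        using usc unfolding usc_on_def by (metis atLeast_iff atLeastAtMost_iff half_gt_zero)
      obtain d2 where d2: "d2 > 0" "\<And>y. y \<in> {0..R} \<Longrightarrow> \<bar>y - x\<bar> < d2 \<Longrightarrow> \<bar>(w y + e * y) - (w x + e * x)\<bar> < r/2"
        using contw x \<open>r > 0\<close> unfolding continuous_on_iff dist_real_def by (meson half_gt_zero)
      have "g y < g x + r" if "y \<in> {0..R}" "\<bar>y - x\<bar> < min d1 d2" for y
        using d1(2)[of y] d2(2)[of y] that unfolding g_def by (smt (verit) atLeastAtMost_iff field_sum_of_halves min_less_iff_conj)
      then show "\<exists>d>0. \<forall>y\<in>{0..R}. \<bar>y - x\<bar> < d \<longrightarrow> g y < g x + r"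
        using d1 d2 by (intro exI[of _ "min d1 d2"]) auto
    qed
    moreover have "0 \<le> R" "x0 \<le> R" using \<open>x0 \<ge> 0\<close> by (auto simp: R_def)
    ultimately obtain x where x: "x \<in> {0..R}" "\<And>y. y \<in> {0..R} \<Longrightarrow> g y \<le> g x"
      using usc_attains_sup by blast
    have gx: "g x \<ge> g x0" using x \<open>0 \<le> x0\<close> \<open>x0 \<le> R\<close> by auto
    \<comment> \<open>Since \<open>g 0 \<le> 0\<close>, a positive maximum is interior, where the
      viscosity inequality is available.\<close>
    have "x \<noteq> 0" using gx gpos init by (auto simp: g_def)
    then have "x > 0" using x by simp
    have gmax: "g y \<le> g x" if "y > 0" for y
    proof (cases "y \<le> R")
      case True
      then show ?thesis using x that by auto
    next
      case False
      then have "(B1 + B2) / e < y" by (simp add: R_def)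
      then have "B1 + B2 < e * y" using e by (simp add: field_simps)
      then show ?thesis using B[of y] that gx gpos by (auto simp: g_def)
    qed
    \<comment> \<open>The constant \<open>g x\<close> makes \<open>phi\<close> agree with
      \<open>u\<close> at \<open>x\<close>, as the definition of a test function demands.\<close>
    define phi where "phi = (\<lambda>y. w y + (e * y + g x))"
    note phi = C2_add_affine[OF C2w, of e "g x", folded phi_def]
    have "s * deriv (deriv phi) x + F (deriv phi x) - c * u x \<ge> 0"
    proof (rule visc[OF \<open>x > 0\<close> phi(1)])
      show "u x - phi x = 0" by (simp add: phi_def g_def)
      show "\<forall>y>0. u y - phi y \<le> u x - phi x" using gmax by (simp add: phi_def g_def algebra_simps)
    qed
    then have "s * deriv (deriv w) x + F (deriv w x + e) - c * u x \<ge> 0" unfolding phi(3) by (simp add: phi(2))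
    moreover have "F (deriv w x + e) - F (deriv w x) \<le> L * e"
      using lip[of "deriv w x + e" "deriv w x"] e by auto
    ultimately have "c * (u x - w x) \<le> L * e"
      using w[OF \<open>x > 0\<close>] by (simp add: algebra_simps)
    then have "u x - w x \<le> L * e / c" using \<open>c > 0\<close> by (simp add: field_simps)
    moreover have "e * x \<ge> 0" using e \<open>x > 0\<close> by simp
    ultimately show False using gx g0 by (simp add: g_def)
  qed
  show ?thesis
  proof (rule field_le_epsilon)
    fix r :: real assume "r > 0"
    \<comment> \<open>Chosen so that \<open>e * x0 + L * e / c + e = r\<close>; the 1 keeps the
      denominator positive.\<close>
    define e where "e = r / (x0 + L / c + 1)"
    have p: "x0 + L / c + 1 > 0" using \<open>L \<ge> 0\<close> \<open>c > 0\<close> \<open>x0 \<ge> 0\<close>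
      by (simp add: add_nonneg_pos)
    then have "e > 0" using \<open>r > 0\<close> by (simp add: e_def)
    have "e * (x0 + L / c + 1) = r" using p by (simp add: e_def)
    then have "e * x0 + L * e / c \<le> r" using \<open>e > 0\<close> by (simp add: algebra_simps)
    then show "u x0 \<le> w x0 + r" using key[OF \<open>e > 0\<close>] by simp
  qed
qed

text \<open>Reflection: \<open>- u\<close> is a subsolution for the Hamiltonian
  \<open>- F (- z)\<close>, which has the same Lipschitz constant.\<close>

lemma comparison_above_classical:
  fixes F u w :: "real \<Rightarrow> real"
  assumes "c > 0" and lip: "\<And>y z. \<bar>F y - F z\<bar> \<le> L * \<bar>y - z\<bar>"
    and lsc: "lsc_on {0..} u" and init: "w 0 \<le> u 0"
    and bu: "bounded (u ` {0..})" and bw: "bounded (w ` {0..})" and C2w: "C2 w"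
    and w: "\<And>x. x > 0 \<Longrightarrow> s * deriv (deriv w) x + F (deriv w x) - c * w x \<ge> 0"
    and visc: "\<And>x phi. x > 0 \<Longrightarrow> C2 phi \<Longrightarrow> u x - phi x = 0 \<Longrightarrow>
       (\<forall>y>0. u y - phi y \<ge> u x - phi x) \<Longrightarrow>
       s * deriv (deriv phi) x + F (deriv phi x) - c * u x \<le> 0"
    and "x0 \<ge> 0"
  shows "w x0 \<le> u x0"
proof -
  have "- u x0 \<le> - w x0"
  proof (rule comparison_below_classical[where F = "\<lambda>z. - F (- z)" and s = s and c = c and L = L
        and u = "\<lambda>x. - u x" and w = "\<lambda>x. - w x"])
    show "\<bar>- F (- y) - - F (- z)\<bar> \<le> L * \<bar>y - z\<bar>" for y z
      using lip[of "- y" "- z"] by (simp add: abs_minus_commute)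
    show "usc_on {0..} (\<lambda>x. - u x)" using lsc unfolding usc_on_def lsc_on_def
      by (simp add: algebra_simps)
    show "bounded ((\<lambda>x. - u x) ` {0..})" "bounded ((\<lambda>x. - w x) ` {0..})"
      using bounded_uminus[THEN iffD2, OF bu] bounded_uminus[THEN iffD2, OF bw] by (simp_all add: image_image)
    show "C2 (\<lambda>x. - w x)" by (rule C2_uminus[OF C2w])
    show "s * deriv (deriv (\<lambda>x. - w x)) x + - F (- deriv (\<lambda>x. - w x) x) - c * - w x \<le> 0" if "x > 0" for x
      using w[OF that] by (simp add: C2_uminus[OF C2w])
    show "s * deriv (deriv phi) x + - F (- deriv phi x) - c * - u x \<ge> 0"
      if "x > 0" "C2 phi" "- u x - phi x = 0" "\<forall>y>0. - u y - phi y \<le> - u x - phi x" for x phi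
    proof -
      note m = C2_uminus[OF that(2)]
      have "u x - - phi x = 0" using that by simp
      moreover have "\<forall>y>0. u y - - phi y \<ge> u x - - phi x" using that by (auto simp: algebra_simps)
      ultimately show ?thesis using visc[OF that(1) m(1)] by (simp add: m)
    qed
  qed (use assms in auto)
  then show ?thesis by simp
qed

text \<open>At a touching point the gradients agree and the second derivatives are ordered, so
  replacing \<open>v\<close> by the test function changes only the second-order term, in the
  required direction.\<close>

lemma classical_imp_visc:
  fixes v :: "real \<Rightarrow> real"
  assumes C2v: "C2 v" and "v 0 = 0"
    and eq: "\<And>x. x > 0 \<Longrightarrow> 1/2 * sig\<^sup>2 * deriv (deriv v) x + fH mu lam a (deriv v x) - c * v x = 0"
  shows "visc_sol mu sig c a lam v"
proof -
  have cont: "continuous_on {0..} v"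
    by (intro C2_continuous_on C2v)
  then have "\<forall>x\<in>{0..}. \<forall>e>0. \<exists>d>0. \<forall>y\<in>{0..}. \<bar>y - x\<bar> < d \<longrightarrow> \<bar>v y - v x\<bar> < e"
    by (simp add: continuous_on_iff dist_real_def)
  then have semi: "usc_on {0..} v" "lsc_on {0..} v"
    unfolding usc_on_def lsc_on_def by (meson abs_diff_less_iff add.commute)+
  \<comment> \<open>The sign \<open>t\<close> treats touching from above and from below at
    once.\<close>
  have touch: "deriv v x = deriv phi x \<and> t * (deriv (deriv v) x - deriv (deriv phi) x) \<le> 0"
    if "x > 0" "C2 phi" and t: "t = 1 \<or> t = -1" and max: "\<forall>y>0. t * (v y - phi y) \<le> t * (v x - phi x)"
    for x phi t
  proof -
    have d1: "((\<lambda>y. t * (v y - phi y)) has_real_derivative t * (deriv v y - deriv phi y)) (at y)" for y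
      by (intro DERIV_cmult DERIV_diff C2D C2v \<open>C2 phi\<close>)
    have d2: "((\<lambda>y. t * (deriv v y - deriv phi y)) has_real_derivative t * (deriv (deriv v) x - deriv (deriv phi) x)) (at x)"
      by (intro DERIV_cmult DERIV_diff C2D C2v \<open>C2 phi\<close>)
    \<comment> \<open>The radius \<open>x\<close> keeps the neighbourhood inside the positive axis,
      where the test inequality is given.\<close>
    have "t * (v y - phi y) \<le> t * (v x - phi x)" if "\<bar>y - x\<bar> < x" for y
      using max that by auto
    from local_max_second_derivative[OF d1 d2 \<open>x > 0\<close> this] t show ?thesis by auto
  qed
  have "1/2 * sig\<^sup>2 * deriv (deriv phi) x + fH mu lam a (deriv phi x) - c * v x \<ge> 0"
    if "x > 0" "C2 phi" "\<forall>y>0. v y - phi y \<le> v x - phi x" for x phi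
  proof -
    have "\<forall>y>0. 1 * (v y - phi y) \<le> 1 * (v x - phi x)" using that(3) by auto
    note tt = touch[OF that(1,2) _ this, simplified]
    have "1/2 * sig\<^sup>2 * deriv (deriv v) x \<le> 1/2 * sig\<^sup>2 * deriv (deriv phi) x"
      using tt by (intro mult_left_mono) auto
    then show ?thesis using tt eq[OF that(1)] that(3) by auto
  qed
  moreover have "1/2 * sig\<^sup>2 * deriv (deriv phi) x + fH mu lam a (deriv phi x) - c * v x \<le> 0"
    if "x > 0" "C2 phi" "\<forall>y>0. v y - phi y \<ge> v x - phi x" for x phi
  proof -
    have "\<forall>y>0. -1 * (v y - phi y) \<le> -1 * (v x - phi x)" using that(3) by auto
    note tt = touch[OF that(1,2) _ this, simplified]
    have "1/2 * sig\<^sup>2 * deriv (deriv v) x \<ge> 1/2 * sig\<^sup>2 * deriv (deriv phi) x"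
      using tt by (intro mult_left_mono) auto
    then show ?thesis using tt eq[OF that(1)] that(3) by auto
  qed
  ultimately show ?thesis
    using cont semi \<open>v 0 = 0\<close> unfolding visc_sol_def visc_sub_def visc_super_def by blast
qed

section \<open>Existence of a bounded classical solution\<close>

lemma integral_has_vector_derivative_half_line:
  fixes f :: "real \<Rightarrow> 'a::banach"
  assumes "continuous_on UNIV f" "t \<ge> 0"
  shows "((\<lambda>t. integral {0..t} f) has_vector_derivative f t) (at t within {0..})"
proof -
  have "((\<lambda>t. integral {0..t} f) has_vector_derivative f t) (at t within {0..t + 1})"
    using assms by (intro integral_has_vector_derivative) (auto intro: continuous_on_subset)
  moreover have "at t within {0..t + 1} = at t within {0..}"
    by (rule at_within_nhd[of _ "{..<t + 1}"]) auto
  ultimately show ?thesis by simp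
qed

text \<open>Integrating an exponential weight gains a factor \<open>1 / N\<close>; this is the
  source of the contraction in the weighted norm below.\<close>

lemma norm_integral_exp_bound:
  fixes f :: "real \<Rightarrow> 'a::banach"
  assumes "continuous_on UNIV f" "N > 0" "t \<ge> 0" "C \<ge> 0"
    and "\<And>s. s \<ge> 0 \<Longrightarrow> norm (f s) \<le> C * exp (N * s)"
  shows "norm (integral {0..t} f) \<le> C / N * exp (N * t)"
proof -
  have "((\<lambda>s. C * exp (N * s)) has_integral C / N * exp (N * t) - C / N * exp (N * 0)) {0..t}"
    using assms by (intro fundamental_theorem_of_calculus)
      (auto intro!: derivative_eq_intros simp: has_real_derivative_iff_has_vector_derivative[symmetric])
  note I = integral_unique[OF this] has_integral_integrable[OF this]
  have "f integrable_on {0..t}"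
    using assms(1) by (intro integrable_continuous_real) (auto intro: continuous_on_subset)
  then have "norm (integral {0..t} f) \<le> integral {0..t} (\<lambda>s. C * exp (N * s))"
    using I(2) assms(5) by (rule integral_norm_bound_integral) auto
  then have "norm (integral {0..t} f) \<le> C / N * exp (N * t) - C / N" unfolding I(1) by simp
  moreover have "C / N \<ge> 0" using assms by simp
  ultimately show ?thesis by linarith
qed

text \<open>Picard iteration is a contraction on the whole half-line in the norm
  \<open>sup (exp (- N * t) * norm (X t))\<close> with \<open>N = 2 * Lam\<close>; the unknown is the rescaled function.\<close>

lemma lipschitz_ivp_global_solution:
  fixes G :: "'a::banach \<Rightarrow> 'a"
  assumes "Lam > 0" and lip: "\<And>x y. norm (G x - G y) \<le> Lam * norm (x - y)"
  obtains X where "X 0 = x0"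
    "\<And>t. t \<ge> 0 \<Longrightarrow> (X has_vector_derivative G (X t)) (at t within {0..})"
proof -
  define N where "N = 2 * Lam"
  have "N > 0" using assms by (simp add: N_def)
  have contG: "continuous_on UNIV G"
    by (rule lipschitz_on_continuous_on[of Lam])
      (use assms in \<open>auto intro!: lipschitz_onI simp: dist_norm\<close>)
  define I where "I q s = G (exp (N * s) *\<^sub>R apply_bcontfun q s)" for q :: "real \<Rightarrow>\<^sub>C 'a" and s
  have contI: "continuous_on UNIV (I q)" for q
    unfolding I_def by (intro continuous_on_compose2[OF contG] continuous_intros) auto
  define J where "J q t = integral {0..t} (I q)" for q t
  have J_deriv: "(J q has_vector_derivative I q t) (at t within {0..})" if "t \<ge> 0" for q t
    unfolding J_def by (rule integral_has_vector_derivative_half_line[OF contI that])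
  \<comment> \<open>Bounded continuous functions live on the whole line here, so the Picard map is
    continued to negative times by its value at 0.\<close>
  define P where "P q t = exp (- N * max 0 t) *\<^sub>R (x0 + J q (max 0 t))" for q t
  have contJ: "continuous_on {0..} (J q)" for q
    using J_deriv by (auto simp: continuous_on_eq_continuous_within intro: has_vector_derivative_continuous)
  have contP: "continuous_on UNIV (P q)" for q
    unfolding P_def by (intro continuous_intros continuous_on_compose2[OF contJ]) auto
  \<comment> \<open>A Lipschitz \<open>G\<close> grows at most linearly, so the integral is at most
    a multiple of \<open>exp (N * r)\<close>, which the weight cancels.\<close>
  have P_bounded: "norm (P q t) \<le> norm x0 + (norm (G 0) + Lam * norm q) / N" for q t
  proof -
    define r where "r = max 0 t"
    have "r \<ge> 0" by (simp add: r_def)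
    have "norm (J q r) \<le> (norm (G 0) + Lam * norm q) / N * exp (N * r)"
      unfolding J_def
    proof (rule norm_integral_exp_bound[OF contI \<open>N > 0\<close> \<open>r \<ge> 0\<close>])
      fix s :: real assume "s \<ge> 0"
      have "norm (I q s) \<le> norm (G 0) + norm (I q s - G 0)" by (rule norm_triangle_sub)
      also have "norm (I q s - G 0) \<le> Lam * (exp (N * s) * norm (apply_bcontfun q s))"
        using lip[of "exp (N * s) *\<^sub>R apply_bcontfun q s" 0] by (simp add: I_def)
      also have "\<dots> \<le> Lam * (exp (N * s) * norm q)"
        using assms norm_bounded[of q s] by (intro mult_left_mono) auto
      also have "norm (G 0) \<le> norm (G 0) * exp (N * s)"
        using \<open>N > 0\<close> \<open>s \<ge> 0\<close> by (simp add: mult_le_cancel_left1)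
      finally show "norm (I q s) \<le> (norm (G 0) + Lam * norm q) * exp (N * s)"
        by (simp add: algebra_simps)
    qed (use assms in auto)
    then have "exp (- N * r) * norm (x0 + J q r) \<le> exp (- N * r) * (norm x0 + (norm (G 0) + Lam * norm q) / N * exp (N * r))"
      by (intro mult_left_mono) (auto intro: norm_triangle_le)
    also have "\<dots> = exp (- N * r) * norm x0 + (norm (G 0) + Lam * norm q) / N"
      by (simp add: distrib_left exp_minus)
    also have "exp (- N * r) * norm x0 \<le> norm x0"
      using \<open>N > 0\<close> \<open>r \<ge> 0\<close> by (simp add: mult_left_le_one_le)
    finally show ?thesis by (simp add: P_def r_def)
  qed
  define T where "T q = Bcontfun (P q)" for q
  have T: "apply_bcontfun (T q) = P q" for q
    unfolding T_def using bcontfun_normI[OF contP P_bounded] by (rule Bcontfun_inverse)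
  have "dist (T q1) (T q2) \<le> 1/2 * dist q1 q2" for q1 q2
  proof (rule dist_bound)
    fix t :: real
    define r where "r = max 0 t"
    have "r \<ge> 0" by (simp add: r_def)
    have "J q1 r - J q2 r = integral {0..r} (\<lambda>s. I q1 s - I q2 s)"
      unfolding J_def using contI by (intro integral_diff[symmetric] integrable_continuous_real) (auto intro: continuous_on_subset)
    also have "norm \<dots> \<le> (Lam * dist q1 q2) / N * exp (N * r)"
    proof (rule norm_integral_exp_bound[OF _ \<open>N > 0\<close> \<open>r \<ge> 0\<close>])
      show "continuous_on UNIV (\<lambda>s. I q1 s - I q2 s)" using contI by (intro continuous_intros)
      fix s :: real
      have "norm (I q1 s - I q2 s) \<le> Lam * (exp (N * s) * dist (apply_bcontfun q1 s) (apply_bcontfun q2 s))"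
        using lip[of "exp (N * s) *\<^sub>R apply_bcontfun q1 s" "exp (N * s) *\<^sub>R apply_bcontfun q2 s"]
        by (simp add: I_def dist_norm flip: scaleR_diff_right)
      also have "\<dots> \<le> Lam * (exp (N * s) * dist q1 q2)"
        using assms dist_bounded[of q1 s q2] by (intro mult_left_mono) auto
      finally show "norm (I q1 s - I q2 s) \<le> Lam * dist q1 q2 * exp (N * s)" by (simp add: algebra_simps)
    qed (use assms in auto)
    \<comment> \<open>The contraction factor is \<open>Lam / N\<close>, which the choice of
      \<open>N\<close> makes equal to 1/2.\<close>
    finally have J12: "norm (J q1 r - J q2 r) \<le> 1/2 * dist q1 q2 * exp (N * r)"
      using assms by (simp add: N_def)
    have "dist (P q1 t) (P q2 t) = exp (- N * r) * norm (J q1 r - J q2 r)"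
      by (simp add: P_def dist_norm flip: r_def scaleR_diff_right)
    also have "\<dots> \<le> exp (- N * r) * (1/2 * dist q1 q2 * exp (N * r))"
      using J12 by (intro mult_left_mono) auto
    also have "\<dots> = 1/2 * dist q1 q2" by (simp add: exp_minus)
    finally show "dist (apply_bcontfun (T q1) t) (apply_bcontfun (T q2) t) \<le> 1/2 * dist q1 q2" by (simp add: T)
  qed
  then obtain q where q: "T q = q"
    using banach_fix_type[of "1/2" T] by auto
  define X where "X t = exp (N * t) *\<^sub>R apply_bcontfun q t" for t
  have X_eq: "X t = x0 + J q t" if "t \<ge> 0" for t
  proof -
    have "apply_bcontfun q t = exp (- N * t) *\<^sub>R (x0 + J q t)"
      using T[of q] q that by (simp add: P_def)
    then show ?thesis by (simp add: X_def exp_minus)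
  qed
  show ?thesis
  proof
    show "X 0 = x0" using X_eq[of 0] by (simp add: J_def)
    fix t :: real assume "t \<ge> 0"
    have "((\<lambda>t. x0 + J q t) has_vector_derivative G (X t)) (at t within {0..})"
      using J_deriv[OF \<open>t \<ge> 0\<close>, of q] by (auto intro!: derivative_eq_intros simp: I_def X_def)
    then show "(X has_vector_derivative G (X t)) (at t within {0..})"
      by (rule has_vector_derivative_transform[rotated 2]) (use X_eq \<open>t \<ge> 0\<close> in auto)
  qed
qed

text \<open>Solutions are produced on the half-line, but \<open>C2\<close> concerns the whole line.
  A global antiderivative of \<open>h\<close> differs from \<open>y\<close> by a constant on the
  half-line; subtracting that constant gives the extension.\<close>

lemma extend_antiderivative:
  fixes y h :: "real \<Rightarrow> real"
  assumes y: "\<And>t. t \<ge> 0 \<Longrightarrow> (y has_real_derivative h t) (at t within {0..})"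
    and h: "continuous_on UNIV h"
  obtains Y where "\<And>t. t \<ge> 0 \<Longrightarrow> Y t = y t" "\<And>t. (Y has_real_derivative h t) (at t)"
proof -
  obtain W where "\<forall>t. -\<infinity> < ereal t \<longrightarrow> ereal t < \<infinity> \<longrightarrow> (W has_vector_derivative h t) (at t)"
    using einterval_antiderivative[of "-\<infinity>" "\<infinity>" h] h by (auto simp: continuous_on_eq_continuous_at)
  then have W: "(W has_real_derivative h t) (at t)" for t
    by (simp add: has_real_derivative_iff_has_vector_derivative)
  have "((\<lambda>t. W t - y t) has_real_derivative 0) (at t within {0..})" if "t \<ge> 0" for t
    using DERIV_diff[OF has_field_derivative_at_within[OF W] y[OF that]] by simp
  then have "\<exists>k. \<forall>t\<in>{0..}. W t - y t = k"
    by (intro has_field_derivative_zero_constant) auto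
  then obtain k where k: "\<And>t. t \<ge> 0 \<Longrightarrow> W t - y t = k" by auto
  have "((\<lambda>t. W t - k) has_real_derivative h t) (at t)" for t
    by (auto intro!: derivative_eq_intros W)
  moreover have "W t - k = y t" if "t \<ge> 0" for t using k[OF that] by simp
  ultimately show ?thesis by (intro that)
qed

text \<open>Regularity is global so that a solution can serve as a test function, while the equation
  is imposed only on the half-line. The initial value is left free so that translates to the left
  qualify.\<close>

definition classical_sol :: "real \<Rightarrow> real \<Rightarrow> (real \<Rightarrow> real) \<Rightarrow> (real \<Rightarrow> real) \<Rightarrow> bool" where
  "classical_sol s c F v \<longleftrightarrow> C2 v \<and> (\<forall>t\<ge>0. s * deriv (deriv v) t + F (deriv v t) - c * v t = 0)"

lemma classical_sol_uminus:
  assumes "classical_sol s c F v"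
  shows "classical_sol s c (\<lambda>z. - F (- z)) (\<lambda>x. - v x)"
proof -
  have C: "C2 v" using assms by (simp add: classical_sol_def)
  show ?thesis using assms unfolding classical_sol_def C2_uminus[OF C]
    by (auto simp: C2_uminus[OF C] algebra_simps)
qed

lemma classical_ivp_solution:
  assumes "s > 0" "c > 0" and lip: "\<And>y z. \<bar>F y - F z\<bar> \<le> L * \<bar>y - z\<bar>"
  obtains v where "classical_sol s c F v" "v 0 = 0" "deriv v 0 = p"
proof -
  have "L \<ge> 0" using lip[of 1 0] by simp
  define G where "G x = (snd x, (c * fst x - F (snd x)) / s)" for x :: "real \<times> real"
  \<comment> \<open>The 1 comes from the first component of \<open>G\<close>, the quotient from the
    second; the norm of a pair is at most the sum of the two.\<close>
  define Lam where "Lam = 1 + (c + L) / s"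
  have "Lam > 0" using assms \<open>L \<ge> 0\<close> by (simp add: Lam_def add_pos_nonneg)
  have "norm (G x - G y) \<le> Lam * norm (x - y)" for x y
  proof -
    have f: "\<bar>fst x - fst y\<bar> \<le> norm (x - y)" "\<bar>snd x - snd y\<bar> \<le> norm (x - y)"
      using norm_fst_le[where x = "fst x - fst y" and y = "snd x - snd y"]
        norm_snd_le[where x = "fst x - fst y" and y = "snd x - snd y"]
      by (simp_all add: minus_prod_def)
    have "\<bar>c * (fst x - fst y) - (F (snd x) - F (snd y))\<bar> \<le> c * \<bar>fst x - fst y\<bar> + L * \<bar>snd x - snd y\<bar>"
      using lip[of "snd x" "snd y"] \<open>c > 0\<close> abs_triangle_ineq4[of "c * (fst x - fst y)" "F (snd x) - F (snd y)"]
      by (auto simp: abs_mult)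
    also have "\<dots> \<le> c * norm (x - y) + L * norm (x - y)"
      using f assms \<open>L \<ge> 0\<close> by (intro add_mono mult_left_mono) auto
    finally have "\<bar>(c * (fst x - fst y) - (F (snd x) - F (snd y))) / s\<bar> \<le> (c + L) / s * norm (x - y)"
      using assms by (simp add: divide_right_mono algebra_simps)
    moreover have "G x - G y = (snd x - snd y, (c * (fst x - fst y) - (F (snd x) - F (snd y))) / s)"
      by (simp add: G_def algebra_simps diff_divide_distrib add_divide_distrib)
    ultimately show ?thesis
      using f(2) norm_Pair_le[of "snd x - snd y" "(c * (fst x - fst y) - (F (snd x) - F (snd y))) / s"]
      by (simp add: Lam_def algebra_simps)
  qed
  then obtain X where X: "X 0 = (0, p)"
    "\<And>t. t \<ge> 0 \<Longrightarrow> (X has_vector_derivative G (X t)) (at t within {0..})"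
    using lipschitz_ivp_global_solution[OF \<open>Lam > 0\<close>, of G "(0, p)"] by blast
  have fstX: "((\<lambda>t. fst (X t)) has_real_derivative snd (X t)) (at t within {0..})" if "t \<ge> 0" for t
    using bounded_linear.has_vector_derivative[OF bounded_linear_fst X(2)[OF that]]
    by (simp add: has_real_derivative_iff_has_vector_derivative G_def)
  have sndX: "((\<lambda>t. snd (X t)) has_real_derivative (c * fst (X t) - F (snd (X t))) / s) (at t within {0..})" if "t \<ge> 0" for t
    using bounded_linear.has_vector_derivative[OF bounded_linear_snd X(2)[OF that]]
    by (simp add: has_real_derivative_iff_has_vector_derivative G_def)
  have contX: "continuous_on {0..} (\<lambda>t. fst (X t))" "continuous_on {0..} (\<lambda>t. snd (X t))"
    using fstX sndX by (auto simp: continuous_on_eq_continuous_within intro: DERIV_continuous)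
  have contF: "continuous_on UNIV F"
    by (rule lipschitz_on_continuous_on[of L])
      (use lip \<open>L \<ge> 0\<close> in \<open>auto intro!: lipschitz_onI simp: dist_real_def\<close>)
  \<comment> \<open>For negative times the acceleration is frozen at its value at 0. It stays
    continuous, so antidifferentiating twice yields a \<open>C2\<close> function.\<close>
  define h where "h t = (c * fst (X (max 0 t)) - F (snd (X (max 0 t)))) / s" for t
  have conth: "continuous_on UNIV h"
    unfolding h_def using assms
    by (intro continuous_intros continuous_on_compose2[OF contF] continuous_on_compose2[OF contX(1)]
        continuous_on_compose2[OF contX(2)]) auto
  obtain Q where Q: "\<And>t. t \<ge> 0 \<Longrightarrow> Q t = snd (X t)" "\<And>t. (Q has_real_derivative h t) (at t)"
    by (rule extend_antiderivative[of "\<lambda>t. snd (X t)" h]) (use sndX conth in \<open>auto simp: h_def\<close>)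
  have contQ: "continuous_on UNIV Q"
    using Q(2) by (auto intro!: continuous_at_imp_continuous_on DERIV_isCont)
  obtain V where V: "\<And>t. t \<ge> 0 \<Longrightarrow> V t = fst (X t)" "\<And>t. (V has_real_derivative Q t) (at t)"
    by (rule extend_antiderivative[of "\<lambda>t. fst (X t)" Q]) (use fstX contQ Q(1) in auto)
  note C2V = C2I[OF V(2) Q(2) conth]
  have "classical_sol s c F V"
    unfolding classical_sol_def C2V(3) unfolding C2V(2) using C2V(1) \<open>s > 0\<close> V(1) Q(1) by (auto simp: h_def)
  moreover have "V 0 = 0" "deriv V 0 = p" using V(1)[of 0] Q(1)[of 0] X(1) by (auto simp: C2V(2))
  ultimately show ?thesis using that by blast
qed

lemma abs_diff_le_deriv_bound:
  fixes g :: "real \<Rightarrow> real"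
  assumes "\<And>x. (g has_real_derivative g' x) (at x)" "t \<ge> 0"
    "\<And>x. 0 \<le> x \<Longrightarrow> x \<le> t \<Longrightarrow> \<bar>g' x\<bar> \<le> B"
  shows "\<bar>g t - g 0\<bar> \<le> B * t"
proof (cases "t = 0")
  case False
  then obtain z where z: "0 < z" "z < t" "g t - g 0 = (t - 0) * g' z"
    using MVT2[of 0 t g g'] assms by auto
  have "\<bar>g' z\<bar> * t \<le> B * t" using assms z by (intro mult_right_mono) auto
  then show ?thesis using z \<open>t \<ge> 0\<close> by (simp add: abs_mult mult.commute)
qed auto

section \<open>Dependence on the initial slope, and shooting\<close>

text \<open>The first bound makes values continuous in the slope, hence the shooting sets open. The
  second says that at one fixed time \<open>t1\<close>, the same for all slopes, the gap between two
  solutions is at least half its linear prediction; this makes the shooting sets nonempty.\<close>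

lemma classical_sol_dependence:
  assumes "s > 0" "c > 0" and lip: "\<And>y z. \<bar>F y - F z\<bar> \<le> L * \<bar>y - z\<bar>"
  obtains K t1 :: real where "t1 > 0"
    "\<And>v w t. classical_sol s c F v \<Longrightarrow> classical_sol s c F w \<Longrightarrow> v 0 = 0 \<Longrightarrow> w 0 = 0 \<Longrightarrow> t \<ge> 0 \<Longrightarrow>
       \<bar>v t - w t\<bar> \<le> \<bar>deriv v 0 - deriv w 0\<bar> * exp (K * t)"
    "\<And>v w. classical_sol s c F v \<Longrightarrow> classical_sol s c F w \<Longrightarrow> v 0 = 0 \<Longrightarrow> w 0 = 0 \<Longrightarrow>
       \<bar>v t1 - w t1 - (deriv v 0 - deriv w 0) * t1\<bar> \<le> \<bar>deriv v 0 - deriv w 0\<bar> * t1 / 2"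
proof -
  have "L \<ge> 0" using lip[of 1 0] by simp
  \<comment> \<open>\<open>2 * K\<close> is the growth rate of
    \<open>(d x)\<^sup>2 + (d1 x)\<^sup>2\<close> for the difference \<open>d\<close> of two
    solutions, so the energy \<open>E\<close> below, weighted by \<open>exp (- 2 * K * x)\<close>,
    does not increase.\<close>
  define K where "K = (1 + c / s + 2 * (L / s)) / 2"
  define C where "C = (c + L) / s * exp K"
  \<comment> \<open>On \<open>{0..1}\<close> the second derivatives differ by at most
    \<open>C\<close> times the slope gap; up to \<open>t1\<close> the gap of the derivatives
    therefore moves by at most half of itself.\<close>
  define t1 where "t1 = min 1 (1 / (2 * C))"
  have "K > 0" unfolding K_def using assms \<open>L \<ge> 0\<close> by (intro divide_pos_pos add_pos_nonneg) auto
  have "C > 0" unfolding C_def using assms \<open>L \<ge> 0\<close> by (simp add: add_pos_nonneg)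
  then have t1: "0 < t1" "t1 \<le> 1" "C * t1 \<le> 1/2" by (auto simp: t1_def min_def field_simps)
  have main: "\<bar>v t - w t\<bar> \<le> \<bar>deriv v 0 - deriv w 0\<bar> * exp (K * t) \<and>
              \<bar>deriv v t - deriv w t\<bar> \<le> \<bar>deriv v 0 - deriv w 0\<bar> * exp (K * t) \<and>
              \<bar>deriv (deriv v) t - deriv (deriv w) t\<bar> \<le> (c + L) / s * (\<bar>deriv v 0 - deriv w 0\<bar> * exp (K * t))"
    if v: "classical_sol s c F v" and w: "classical_sol s c F w" and "v 0 = 0" "w 0 = 0" "t \<ge> 0" for v w t
  proof -
    define d where "d x = v x - w x" for x
    define d1 where "d1 x = deriv v x - deriv w x" for x
    define d2 where "d2 x = deriv (deriv v) x - deriv (deriv w) x" for x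
    have C2: "C2 v" "C2 w" using v w by (auto simp: classical_sol_def)
    have D: "(d has_real_derivative d1 x) (at x)" "(d1 has_real_derivative d2 x) (at x)" for x
      unfolding d_def d1_def d2_def by (intro derivative_intros C2D C2)+
    have d2_bound: "\<bar>d2 x\<bar> \<le> c / s * \<bar>d x\<bar> + L / s * \<bar>d1 x\<bar>" if "x \<ge> 0" for x
    proof -
      have "s * d2 x = c * d x - (F (deriv v x) - F (deriv w x))"
      proof -
        have "s * deriv (deriv v) x = c * v x - F (deriv v x)" "s * deriv (deriv w) x = c * w x - F (deriv w x)"
          using v w that by (simp_all add: classical_sol_def eq_diff_eq add.commute)
        then show ?thesis by (simp add: d_def d2_def right_diff_distrib)
      qed
      then have "\<bar>s * d2 x\<bar> = \<bar>c * d x - (F (deriv v x) - F (deriv w x))\<bar>" by simp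
      then have "s * \<bar>d2 x\<bar> \<le> c * \<bar>d x\<bar> + L * \<bar>d1 x\<bar>"
        using lip[of "deriv v x" "deriv w x"] \<open>s > 0\<close> \<open>c > 0\<close>
          abs_triangle_ineq4[of "c * d x" "F (deriv v x) - F (deriv w x)"]
        by (simp add: d1_def abs_mult)
      then show ?thesis using assms by (simp add: field_simps)
    qed
    define E where "E x = ((d x)\<^sup>2 + (d1 x)\<^sup>2) * exp (- 2 * K * x)" for x
    have "E t \<le> E 0"
    proof (rule DERIV_nonpos_imp_nonincreasing[OF \<open>t \<ge> 0\<close>])
      fix x :: real assume x: "0 \<le> x" "x \<le> t"
      have "(E has_real_derivative (2 * d x * d1 x + 2 * d1 x * d2 x - 2 * K * ((d x)\<^sup>2 + (d1 x)\<^sup>2)) * exp (- 2 * K * x)) (at x)"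
        unfolding E_def by (auto intro!: derivative_eq_intros D simp: algebra_simps)
      moreover have "2 * d x * d1 x + 2 * d1 x * d2 x \<le> 2 * K * ((d x)\<^sup>2 + (d1 x)\<^sup>2)"
      proof -
        have m: "2 * (\<bar>d x\<bar> * \<bar>d1 x\<bar>) \<le> (d x)\<^sup>2 + (d1 x)\<^sup>2"
          using sum_squares_bound[of "\<bar>d x\<bar>" "\<bar>d1 x\<bar>"] by (simp add: mult.assoc)
        have "d x * d1 x \<le> \<bar>d x\<bar> * \<bar>d1 x\<bar>" unfolding abs_mult[symmetric] by (rule abs_ge_self)
        moreover have "d1 x * d2 x \<le> \<bar>d1 x\<bar> * (c / s * \<bar>d x\<bar> + L / s * \<bar>d1 x\<bar>)"
        proof -
          have "d1 x * d2 x \<le> \<bar>d1 x\<bar> * \<bar>d2 x\<bar>" unfolding abs_mult[symmetric] by (rule abs_ge_self)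
          also have "\<dots> \<le> \<bar>d1 x\<bar> * (c / s * \<bar>d x\<bar> + L / s * \<bar>d1 x\<bar>)"
            by (rule mult_left_mono[OF d2_bound[OF x(1)]]) simp
          finally show ?thesis .
        qed
        ultimately have bounds: "d x * d1 x \<le> \<bar>d x\<bar> * \<bar>d1 x\<bar>"
          "d1 x * d2 x \<le> \<bar>d1 x\<bar> * (c / s * \<bar>d x\<bar> + L / s * \<bar>d1 x\<bar>)" .
        have "2 * d x * d1 x + 2 * d1 x * d2 x \<le>
             (1 + c / s) * (2 * (\<bar>d x\<bar> * \<bar>d1 x\<bar>)) + 2 * (L / s) * (d1 x)\<^sup>2"
        proof -
          have "(1 + c / s) * (2 * (\<bar>d x\<bar> * \<bar>d1 x\<bar>)) + 2 * (L / s) * (d1 x)\<^sup>2 =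
              2 * (\<bar>d x\<bar> * \<bar>d1 x\<bar>) + 2 * (\<bar>d1 x\<bar> * (c / s * \<bar>d x\<bar> + L / s * \<bar>d1 x\<bar>))"
            by (simp add: algebra_simps power2_eq_square)
          with bounds show ?thesis by linarith
        qed
        also have "\<dots> \<le> (1 + c / s) * ((d x)\<^sup>2 + (d1 x)\<^sup>2) + 2 * (L / s) * ((d x)\<^sup>2 + (d1 x)\<^sup>2)"
          using m assms \<open>L \<ge> 0\<close> by (intro add_mono mult_left_mono) auto
        also have "\<dots> = 2 * K * ((d x)\<^sup>2 + (d1 x)\<^sup>2)" by (simp add: K_def algebra_simps)
        finally show ?thesis .
      qed
      ultimately show "\<exists>y. (E has_real_derivative y) (at x) \<and> y \<le> 0"
        by (intro exI conjI) (assumption, simp add: mult_nonpos_nonneg)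
    qed
    then have "(d t)\<^sup>2 + (d1 t)\<^sup>2 \<le> (\<bar>d1 0\<bar> * exp (K * t))\<^sup>2"
      using \<open>v 0 = 0\<close> \<open>w 0 = 0\<close>
      by (simp add: E_def d_def power_mult_distrib exp_minus field_simps flip: exp_of_nat_mult)
    then have "(d t)\<^sup>2 \<le> (\<bar>d1 0\<bar> * exp (K * t))\<^sup>2" "(d1 t)\<^sup>2 \<le> (\<bar>d1 0\<bar> * exp (K * t))\<^sup>2"
      using zero_le_power2[of "d t"] zero_le_power2[of "d1 t"] by linarith+
    then have b: "\<bar>d t\<bar> \<le> \<bar>d1 0\<bar> * exp (K * t)" "\<bar>d1 t\<bar> \<le> \<bar>d1 0\<bar> * exp (K * t)"
      by (auto intro!: power2_le_imp_le[of "\<bar>d t\<bar>"] power2_le_imp_le[of "\<bar>d1 t\<bar>"])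
    have "\<bar>d2 t\<bar> \<le> c / s * (\<bar>d1 0\<bar> * exp (K * t)) + L / s * (\<bar>d1 0\<bar> * exp (K * t))"
      using b \<open>s > 0\<close> \<open>c > 0\<close> \<open>L \<ge> 0\<close>
      by (intro order_trans[OF d2_bound[OF \<open>t \<ge> 0\<close>]] add_mono mult_left_mono) auto
    then have "\<bar>d2 t\<bar> \<le> (c + L) / s * (\<bar>d1 0\<bar> * exp (K * t))" by (simp add: add_divide_distrib distrib_right)
    with b show ?thesis by (simp add: d_def d1_def d2_def)
  qed
  have "\<bar>v t1 - w t1 - (deriv v 0 - deriv w 0) * t1\<bar> \<le> \<bar>deriv v 0 - deriv w 0\<bar> * t1 / 2"
    if v: "classical_sol s c F v" and w: "classical_sol s c F w" and "v 0 = 0" "w 0 = 0" for v w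
  proof -
    define D where "D = deriv v 0 - deriv w 0"
    have C2: "C2 v" "C2 w" using v w by (auto simp: classical_sol_def)
    have d2: "\<bar>deriv (deriv v) x - deriv (deriv w) x\<bar> \<le> C * \<bar>D\<bar>" if "0 \<le> x" "x \<le> t1" for x
    proof -
      have "K * x \<le> K * 1" using that t1 \<open>K > 0\<close> by (intro mult_left_mono) auto
      then have "(c + L) / s * (\<bar>D\<bar> * exp (K * x)) \<le> (c + L) / s * (\<bar>D\<bar> * exp K)"
        using assms \<open>L \<ge> 0\<close> by (intro mult_left_mono) auto
      then show ?thesis using main[OF v w \<open>v 0 = 0\<close> \<open>w 0 = 0\<close> that(1)] by (simp add: C_def D_def mult.commute mult.left_commute)
    qed
    have d1: "\<bar>deriv v x - deriv w x - D\<bar> \<le> \<bar>D\<bar> / 2" if "0 \<le> x" "x \<le> t1" for x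
    proof -
      have "\<bar>(deriv v x - deriv w x) - (deriv v 0 - deriv w 0)\<bar> \<le> C * \<bar>D\<bar> * x"
      proof (rule abs_diff_le_deriv_bound[where g = "\<lambda>y. deriv v y - deriv w y"])
        show "((\<lambda>y. deriv v y - deriv w y) has_real_derivative deriv (deriv v) y - deriv (deriv w) y) (at y)" for y
          by (intro DERIV_diff C2D C2)
      qed (use that d2 in auto)
      also have "\<dots> \<le> C * \<bar>D\<bar> * t1" using \<open>C > 0\<close> that by (intro mult_left_mono) auto
      also have "\<dots> \<le> \<bar>D\<bar> / 2" using mult_right_mono[OF t1(3), of "\<bar>D\<bar>"] by (simp add: algebra_simps)
      finally show ?thesis by (simp add: D_def)
    qed
    have "\<bar>(v t1 - w t1 - D * t1) - (v 0 - w 0 - D * 0)\<bar> \<le> \<bar>D\<bar> / 2 * t1"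
    proof (rule abs_diff_le_deriv_bound[where g = "\<lambda>x. v x - w x - D * x"])
      show "((\<lambda>x. v x - w x - D * x) has_real_derivative deriv v x - deriv w x - D) (at x)" for x
        by (auto intro!: derivative_eq_intros C2D C2)
    qed (use t1 d1 in auto)
    then show ?thesis using \<open>v 0 = 0\<close> \<open>w 0 = 0\<close> by (simp add: D_def)
  qed
  from that[OF t1(1) conjunct1[OF main] this] show ?thesis .
qed

text \<open>Such a path has an interior maximum above \<open>K\<close>. There the gradient vanishes
  and the second derivative is nonpositive, so the equation forces
  \<open>c * v \<le> F 0 < c * K\<close>, a contradiction.\<close>

lemma no_return_from_high:
  assumes v: "classical_sol s c F v" "s \<ge> 0" "v 0 = 0"
    and "K \<ge> 0" "F 0 < c * K" "c > 0" and t: "0 \<le> t1" "t1 < t2" "v t1 > K" "v t2 \<le> 0"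
  shows False
proof -
  have C2: "C2 v" using v by (simp add: classical_sol_def)
  have "continuous_on {0..t2} v"
    by (intro C2_continuous_on C2)
  then obtain x where x: "x \<in> {0..t2}" "\<And>y. y \<in> {0..t2} \<Longrightarrow> v y \<le> v x"
    using continuous_attains_sup[of "{0..t2}" v] t by auto
  have "v x > K" using x(2)[of t1] t by auto
  then have "x \<noteq> 0" "x \<noteq> t2" using v t \<open>K \<ge> 0\<close> by auto
  define r where "r = min x (t2 - x)"
  have "r > 0" using x \<open>x \<noteq> 0\<close> \<open>x \<noteq> t2\<close> by (auto simp: r_def)
  have "v y \<le> v x" if "\<bar>y - x\<bar> < r" for y
    using that by (intro x(2)) (auto simp: r_def)
  note m = local_max_second_derivative[OF C2D(1)[OF C2] C2D(2)[OF C2] \<open>r > 0\<close> this]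
  have "s * deriv (deriv v) x + F (deriv v x) - c * v x = 0"
    using v x by (auto simp: classical_sol_def)
  moreover have "s * deriv (deriv v) x \<le> 0" using m \<open>s \<ge> 0\<close> by (simp add: mult_nonneg_nonpos)
  moreover have "c * K < c * v x" using \<open>v x > K\<close> \<open>c > 0\<close> by simp
  ultimately show False using m \<open>F 0 < c * K\<close> by simp
qed

text \<open>Shooting in the initial slope: the slopes whose solution exceeds \<open>K\<close> and those whose solution
  falls below \<open>- K\<close> form disjoint nonempty open sets, which cannot cover the connected real line.\<close>

lemma bounded_classical_sol_exists:
  assumes "s > 0" "c > 0" and lip: "\<And>y z. \<bar>F y - F z\<bar> \<le> L * \<bar>y - z\<bar>"
  obtains v where "classical_sol s c F v" "v 0 = 0" "bounded (v ` {0..})"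
proof -
  have "\<exists>v. classical_sol s c F v \<and> v 0 = 0 \<and> deriv v 0 = p" for p
    using classical_ivp_solution[OF assms, of p] by blast
  then obtain V where V: "\<And>p. classical_sol s c F (V p)" "\<And>p. V p 0 = 0" "\<And>p. deriv (V p) 0 = p"
    by metis
  \<comment> \<open>Strictly above \<open>|F 0| / c\<close>, so that the barrier works for
    \<open>F\<close> and for the reflected Hamiltonian alike.\<close>
  define K where "K = \<bar>F 0\<bar> / c + 1"
  have K: "K \<ge> 0" "F 0 < c * K" "- F 0 < c * K"
    using \<open>c > 0\<close> by (auto simp: K_def distrib_left)
  obtain N t1 :: real where "t1 > 0"
    and dep: "\<And>p q t. t \<ge> 0 \<Longrightarrow> \<bar>V p t - V q t\<bar> \<le> \<bar>p - q\<bar> * exp (N * t)"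
    and slope: "\<And>p q. \<bar>V p t1 - V q t1 - (p - q) * t1\<bar> \<le> \<bar>p - q\<bar> * t1 / 2"
  proof -
    obtain N t1 :: real where "t1 > 0"
      and d1: "\<And>v w t. classical_sol s c F v \<Longrightarrow> classical_sol s c F w \<Longrightarrow> v 0 = 0 \<Longrightarrow> w 0 = 0 \<Longrightarrow> t \<ge> 0 \<Longrightarrow>
        \<bar>v t - w t\<bar> \<le> \<bar>deriv v 0 - deriv w 0\<bar> * exp (N * t)"
      and d2: "\<And>v w. classical_sol s c F v \<Longrightarrow> classical_sol s c F w \<Longrightarrow> v 0 = 0 \<Longrightarrow> w 0 = 0 \<Longrightarrow>
       \<bar>v t1 - w t1 - (deriv v 0 - deriv w 0) * t1\<bar> \<le> \<bar>deriv v 0 - deriv w 0\<bar> * t1 / 2"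
      by (rule classical_sol_dependence[OF assms]) (assumption | rule that)+
    show ?thesis
      by (rule that[OF \<open>t1 > 0\<close> d1[OF V(1) V(1) V(2) V(2), unfolded V(3)] d2[OF V(1) V(1) V(2) V(2), unfolded V(3)]])
  qed
  have cont: "continuous_on UNIV (\<lambda>p. V p t)" if "t \<ge> 0" for t
    by (rule lipschitz_on_continuous_on[of "exp (N * t)"])
      (use dep[OF that] in \<open>auto intro!: lipschitz_onI simp: dist_real_def mult.commute\<close>)
  define U where "U = (\<Union>t\<in>{0..}. {p. K < V p t})"
  define D where "D = (\<Union>t\<in>{0..}. {p. V p t < - K})"
  have "open U" "open D"
    unfolding U_def D_def by (auto intro!: open_UN open_Collect_less cont continuous_intros)
  moreover have "U \<inter> D = {}"
  proof -
    \<comment> \<open>If the high value comes first, the barrier applies to the solution itself,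
      otherwise to its negative.\<close>
    have False if "0 \<le> t" "0 \<le> r" "K < V p t" "V p r < - K" for p t r
    proof (cases "t < r")
      case True
      then show ?thesis
        using no_return_from_high[OF V(1)[of p] _ V(2) K(1,2) \<open>c > 0\<close> \<open>0 \<le> t\<close> True] that K \<open>s > 0\<close> by auto
    next
      case False
      with that K have "r < t" by (cases "r = t") auto
      then show ?thesis
        using no_return_from_high[OF classical_sol_uminus[OF V(1)[of p]] _ _ K(1) _ \<open>c > 0\<close> \<open>0 \<le> r\<close> \<open>r < t\<close>] that K V(2) \<open>s > 0\<close>
        by auto
    qed
    then show ?thesis by (auto simp: U_def D_def)
  qed
  moreover have "U \<noteq> {}" "D \<noteq> {}"
  proof -
    \<comment> \<open>Here \<open>V 0\<close> is the solution with slope zero. By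
      \<open>slope\<close>, the slope \<open>p\<close> lifts it at time \<open>t1\<close> by at
      least \<open>p * t1 / 2\<close>, which is made large enough to pass \<open>K\<close>;
      \<open>- p\<close> does the opposite.\<close>
    define p where "p = 2 * (K + \<bar>V 0 t1\<bar> + 1) / t1"
    have p: "p * t1 / 2 = K + \<bar>V 0 t1\<bar> + 1" "p \<ge> 0" using \<open>t1 > 0\<close> K by (auto simp: p_def)
    have "\<bar>V p t1 - V 0 t1 - p * t1\<bar> \<le> p * t1 / 2" "\<bar>V (- p) t1 - V 0 t1 + p * t1\<bar> \<le> p * t1 / 2"
      using slope[of p 0] slope[of "- p" 0] p(2) by simp_all
    then have "V p t1 - V 0 t1 \<ge> p * t1 / 2" "V (- p) t1 - V 0 t1 \<le> - (p * t1 / 2)" by linarith+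
    then have "V p t1 > K" "V (- p) t1 < - K" using p(1) abs_ge_self[of "V 0 t1"] abs_ge_minus_self[of "V 0 t1"] by simp_all
    then show "U \<noteq> {}" "D \<noteq> {}" using \<open>t1 > 0\<close> by (force simp: U_def D_def)+
  qed
  ultimately have "U \<union> D \<noteq> UNIV"
    using connected_UNIV[where 'a = real] by (auto simp: connected_def)
  then obtain p where "p \<notin> U" "p \<notin> D" by auto
  then have "\<bar>V p t\<bar> \<le> K" if "t \<ge> 0" for t
    using that by (force simp: U_def D_def not_less abs_le_iff)
  then have "bounded (V p ` {0..})" by (intro boundedI[of _ K]) auto
  then show ?thesis using that V by blast
qed

section \<open>Identification of the Perron solution\<close>

lemma visc_sub_le_classical:
  assumes "sig > 0" "c > 0" "a > 0" "lam > 0"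
    and u: "visc_sub mu sig c a lam u" "bounded (u ` {0..})"
    and w: "classical_sol (1/2 * sig\<^sup>2) c (fH mu lam a) w" "bounded (w ` {0..})" "0 \<le> w 0"
    and "x \<ge> 0"
  shows "u x \<le> w x"
  by (rule comparison_below_classical[where F = "fH mu lam a" and s = "1/2 * sig\<^sup>2" and c = c,
        OF \<open>c > 0\<close> fH_lipschitz[OF \<open>a > 0\<close> \<open>lam > 0\<close>]])
    (use assms in \<open>auto simp: visc_sub_def classical_sol_def\<close>)

lemma classical_le_visc_super:
  assumes "sig > 0" "c > 0" "a > 0" "lam > 0"
    and u: "visc_super mu sig c a lam u" "bounded (u ` {0..})"
    and w: "classical_sol (1/2 * sig\<^sup>2) c (fH mu lam a) w" "bounded (w ` {0..})" "w 0 \<le> 0"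
    and "x \<ge> 0"
  shows "w x \<le> u x"
  by (rule comparison_above_classical[where F = "fH mu lam a" and s = "1/2 * sig\<^sup>2" and c = c,
        OF \<open>c > 0\<close> fH_lipschitz[OF \<open>a > 0\<close> \<open>lam > 0\<close>]])
    (use assms in \<open>auto simp: visc_super_def classical_sol_def\<close>)

text \<open>Needed because the supremum \<open>vhat\<close> is controlled only on the half-line:
  members of the family are arbitrary at negative arguments.\<close>

lemma visc_sol_cong:
  assumes "\<And>x. x \<ge> 0 \<Longrightarrow> v x = w x"
  shows "visc_sol mu sig c a lam v \<longleftrightarrow> visc_sol mu sig c a lam w"
proof -
  have "continuous_on {0..} v \<longleftrightarrow> continuous_on {0..} w"
    by (rule continuous_on_cong) (use assms in auto)
  then show ?thesis
    using assms by (simp add: visc_sol_def visc_sub_def visc_super_def usc_on_def lsc_on_def)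
qed

section \<open>Envelopes and barriers\<close>

text \<open>The envelopes range over neighbourhoods of every radius, including large ones;
  boundedness of \<open>v\<close> makes all the suprema and infima involved meaningful.\<close>

lemma semicontinuous_env_continuous:
  fixes v :: "real \<Rightarrow> real"
  assumes cont: "continuous_on {0..} v" and bdd: "bounded (v ` {0..})" and "x \<ge> 0"
  shows "usc_env v x = v x" "lsc_env v x = v x"
proof -
  define S where "S d = v ` {y. 0 \<le> y \<and> \<bar>y - x\<bar> < d}" for d
  have sub: "S d \<subseteq> v ` {0..}" for d by (auto simp: S_def)
  have bd: "bdd_above (S d)" "bdd_below (S d)" for d
    using bounded_subset[OF bdd sub] bounded_imp_bdd_above bounded_imp_bdd_below by auto
  have mem: "v x \<in> S d" if "d > 0" for d using that \<open>x \<ge> 0\<close> by (auto simp: S_def)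
  have small: "\<exists>d>0. \<forall>z\<in>S d. \<bar>z - v x\<bar> < e" if "e > 0" for e
    using cont \<open>x \<ge> 0\<close> that unfolding continuous_on_iff dist_real_def S_def by fastforce
  have up: "v x \<le> Sup (S d)" if "d > 0" for d using cSup_upper[OF mem[OF that] bd(1)] .
  have low: "Inf (S d) \<le> v x" if "d > 0" for d using cInf_lower[OF mem[OF that] bd(2)] .
  show "usc_env v x = v x"
  proof (rule antisym)
    show "v x \<le> usc_env v x"
      unfolding usc_env_def S_def[symmetric] using up by (intro cINF_greatest) auto
    show "usc_env v x \<le> v x"
    proof (rule field_le_epsilon)
      fix e :: real assume "e > 0"
      then obtain d where d: "d > 0" "\<forall>z\<in>S d. \<bar>z - v x\<bar> < e" using small by blast
      have "usc_env v x \<le> Sup (S d)"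
        unfolding usc_env_def S_def[symmetric] using up d(1) by (intro cINF_lower bdd_belowI2) auto
      also have "\<dots> \<le> v x + e" using d mem[OF d(1)] by (intro cSup_least) fastforce+
      finally show "usc_env v x \<le> v x + e" .
    qed
  qed
  show "lsc_env v x = v x"
  proof (rule antisym)
    show "lsc_env v x \<le> v x"
      unfolding lsc_env_def S_def[symmetric] using low by (intro cSUP_least) auto
    show "v x \<le> lsc_env v x"
    proof (rule field_le_epsilon)
      fix e :: real assume "e > 0"
      then obtain d where d: "d > 0" "\<forall>z\<in>S d. \<bar>z - v x\<bar> < e" using small by blast
      have "v x - e \<le> Inf (S d)" using d mem[OF d(1)] by (intro cInf_greatest) fastforce+
      also have "\<dots> \<le> lsc_env v x"
        unfolding lsc_env_def S_def[symmetric] using low d(1) by (intro cSUP_upper bdd_aboveI2) auto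
      finally show "v x \<le> lsc_env v x + e" by simp
    qed
  qed
qed

lemma bounded_psi_low: "bounded (psi_low ` {0..})"
  by (auto intro!: boundedI[of _ 1] simp: psi_low_def)

text \<open>For \<open>x \<ge> 0\<close> the cut at \<open>b\<close> keeps \<open>|min x b|\<close>
  below \<open>|b|\<close>, so the exponent stays in a bounded range whatever the signs of the
  parameters.\<close>

lemma bounded_psi_up: "bounded (psi_up A M b ` {0..})"
proof (rule boundedI)
  fix y assume "y \<in> psi_up A M b ` {0..}"
  then obtain x where x: "x \<ge> 0" "y = psi_up A M b x" by auto
  have "\<bar>min x b\<bar> \<le> \<bar>b\<bar>" using x by auto
  then have "\<bar>M\<bar> * \<bar>min x b\<bar> \<le> \<bar>M\<bar> * \<bar>b\<bar>" by (rule mult_left_mono) simp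
  then have "exp (- M * min x b) \<le> exp (\<bar>M\<bar> * \<bar>b\<bar>)" by (simp flip: abs_mult)
  then have "\<bar>1 - exp (- M * min x b)\<bar> \<le> 1 + exp (\<bar>M\<bar> * \<bar>b\<bar>)"
    using exp_gt_zero[of "- M * min x b"] by linarith
  then have "\<bar>A / M\<bar> * \<bar>1 - exp (- M * min x b)\<bar> \<le> \<bar>A / M\<bar> * (1 + exp (\<bar>M\<bar> * \<bar>b\<bar>))"
    by (rule mult_left_mono) simp
  then show "norm y \<le> \<bar>A / M\<bar> * (1 + exp (\<bar>M\<bar> * \<bar>b\<bar>))"
    by (simp only: x psi_up_def real_norm_def abs_mult)
qed

theorem mainTheorem6:
  fixes mu sig c a lam A M b :: real
  assumes "sig > 0" "c > 0" "a > 0" "lam > 0"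
    and A1: "a > max 1 (2 * mu)" and A2: "mu > max c (sig\<^sup>2 / 2)"
    and psi_sub: "visc_sub mu sig c a lam psi_low"
    and psi_super: "visc_super mu sig c a lam (psi_up A M b)"
    and psi_le: "\<forall>x\<ge>0. psi_low x \<le> psi_up A M b x"
  shows "(\<forall>vsup vsub. visc_super mu sig c a lam vsup \<and> classL vsup \<and>
                      visc_sub mu sig c a lam vsub \<and> classL vsub \<longrightarrow>
                      (\<forall>x\<ge>0. vsub x \<le> vsup x))
       \<and> (\<forall>x\<ge>0. usc_env (vhat mu sig c a lam A M b) x = vhat mu sig c a lam A M b x
                \<and> lsc_env (vhat mu sig c a lam A M b) x = vhat mu sig c a lam A M b x)
       \<and> visc_sol mu sig c a lam (vhat mu sig c a lam A M b)
       \<and> classL (vhat mu sig c a lam A M b)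
       \<and> (\<forall>w. visc_sol mu sig c a lam w \<and> classL w \<longrightarrow>
               (\<forall>x\<ge>0. w x = vhat mu sig c a lam A M b x))"
proof -
  have "1/2 * sig\<^sup>2 > 0" using \<open>sig > 0\<close> by simp
  then obtain v where v: "classical_sol (1/2 * sig\<^sup>2) c (fH mu lam a) v" "v 0 = 0" "bounded (v ` {0..})"
    using bounded_classical_sol_exists \<open>c > 0\<close> fH_lipschitz[OF \<open>a > 0\<close> \<open>lam > 0\<close>] by blast
  have C2v: "C2 v" using v by (simp add: classical_sol_def)
  have v_visc: "visc_sol mu sig c a lam v"
    by (rule classical_imp_visc) (use v in \<open>auto simp: classical_sol_def\<close>)
  have sub_le: "u x \<le> v x" if "visc_sub mu sig c a lam u" "bounded (u ` {0..})" "x \<ge> 0" for u x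
    using visc_sub_le_classical[OF assms(1-4) that(1,2) v(1,3)] v(2) that(3) by simp
  have super_ge: "v x \<le> u x" if "visc_super mu sig c a lam u" "bounded (u ` {0..})" "x \<ge> 0" for u x
    using classical_le_visc_super[OF assms(1-4) that(1,2) v(1,3)] v(2) that(3) by simp
  \<comment> \<open>Comparison applied to the two barriers themselves gives the bounds required of a
    member of the Perron family.\<close>
  have low: "psi_low x \<le> v x" if "x \<ge> 0" for x using sub_le[OF psi_sub bounded_psi_low that] .
  have up: "v x \<le> psi_up A M b x" if "x \<ge> 0" for x using super_ge[OF psi_super bounded_psi_up that] .
  \<comment> \<open>The equation is autonomous, so \<open>v\<close> can be compared with its own translates.\<close>
  have v_mono: "v x \<le> v (x + h)" if "x \<ge> 0" "h \<ge> 0" for x h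
  proof (rule visc_sub_le_classical[OF assms(1-4) _ v(3) _ _ _ \<open>x \<ge> 0\<close>])
    show "visc_sub mu sig c a lam v" using v_visc by (simp add: visc_sol_def)
    show "classical_sol (1/2 * sig\<^sup>2) c (fH mu lam a) (\<lambda>x. v (x + h))"
      using v(1) \<open>h \<ge> 0\<close> C2_translate[OF C2v] unfolding classical_sol_def by simp
    show "bounded ((\<lambda>x. v (x + h)) ` {0..})"
      by (rule bounded_subset[OF v(3)]) (use \<open>h \<ge> 0\<close> in auto)
    \<comment> \<open>The lower barrier gives \<open>v h \<ge> 0 = v 0\<close>, the initial ordering
      between \<open>v\<close> and its translate.\<close>
    have "psi_low h \<ge> 0" using \<open>h \<ge> 0\<close> by (simp add: psi_low_def)
    then show "0 \<le> v (0 + h)" using low[OF \<open>h \<ge> 0\<close>] by simp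
  qed
  have "mono_on {0..} v"
  proof (rule mono_onI)
    fix x y :: real assume "x \<in> {0..}" "x \<le> y"
    then show "v x \<le> v y" using v_mono[of x "y - x"] by simp
  qed
  then have v_L: "classL v" using v(3) by (simp add: classL_def)
  have v_F: "v \<in> famF mu sig c a lam A M b"
    using v_visc v_L low up by (simp add: famF_def visc_sol_def)
  define V where "V = vhat mu sig c a lam A M b"
  have V: "V x = v x" if "x \<ge> 0" for x
    unfolding V_def vhat_def
  proof (rule cSup_eq_maximum)
    show "v x \<in> (\<lambda>u. u x) ` famF mu sig c a lam A M b" using v_F by auto
    show "z \<le> v x" if "z \<in> (\<lambda>u. u x) ` famF mu sig c a lam A M b" for z
      using that sub_le \<open>x \<ge> 0\<close> by (auto simp: famF_def classL_def)
  qed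
  have V_visc: "visc_sol mu sig c a lam V" using visc_sol_cong[of V v] V v_visc by auto
  have "V ` {0..} = v ` {0..}" using V by (auto intro!: image_cong)
  then have V_L: "classL V" using v_L V by (auto simp: classL_def mono_on_def)
  have "usc_env V x = V x \<and> lsc_env V x = V x" if "x \<ge> 0" for x
    using semicontinuous_env_continuous[OF _ _ that] V_visc V_L by (auto simp: visc_sol_def classL_def)
  moreover have "vsub x \<le> vsup x"
    if "visc_super mu sig c a lam vsup \<and> classL vsup \<and> visc_sub mu sig c a lam vsub \<and> classL vsub" "x \<ge> 0"
    for vsub vsup x
    using that sub_le[of vsub x] super_ge[of vsup x] by (auto simp: classL_def)
  moreover have "w x = V x" if "visc_sol mu sig c a lam w \<and> classL w" "x \<ge> 0" for w x
    using that sub_le[of w x] super_ge[of w x] V by (auto simp: classL_def visc_sol_def)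
  ultimately show ?thesis
    unfolding V_def[symmetric] using V_visc V_L by blast
qed

end
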